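(* Let $g$ lie in $\mathcal{D}^p\cap\mathcal{K}^p$ for some $p\in\mathbb{N}$. Let $x>0$ be such that $g$ is $p$-convex or $p$-concave on $[x,\infty)$, let $\pm$ stand for $1$ or $-1$ according to whether $g$ is $p$-convex or $p$-concave on $[x,\infty)$, and let $a\ge 0$. Then $$0\le\pm(-1)\,\varepsilon_{p+1}(a)\,\rho_x^{p+1}[\Sigma g](a)\le\pm(-1)\left|\binom{a-1}{p}\right|\left(\Delta^p\Sigma g(x+a)-\Delta^p\Sigma g(x)\right)\le\pm(-1)\lceil a\rceil\left|\binom{a-1}{p}\right|\Delta^pg(x),$$ with equalities if $a\in\{0,1,\ldots,p\}$. In particular, for each $a\ge 0$, $\rho_x^{p+1}[\Sigma g](a)\to 0$ as $x\to\infty$. If $p\ge 1$, we also have $$0\le\pm(-1)\,\varepsilon_p(a)\,\rho_x^p[g](a)\le\pm(-1)\left|\binom{a-1}{p-1}\right|\left(\Delta^{p-1}g(x+a)-\Delta^{p-1}g(x)\right)\le\pm(-1)\lceil a\rceil\left|\binom{a-1}{p-1}\right|\Delta^pg(x),$$ with equalities if $a\in\{0,1,\ldots,p-1\}$. In particular, for each $a\ge 0$, $\rho_x^p[g](a)\to 0$ as $x\to\infty$.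
   Context: $\mathbb{N}=\{0,1,2,\ldots\}$, $\mathbb{R}_+=(0,\infty)$, $\Delta f(x)=f(x+1)-f(x)$. For an integer $p\ge -1$, a function $f\colon I\to\mathbb{R}$ on a real interval $I$ is $p$-convex (resp. $p$-concave) if for all $x_0<\cdots<x_{p+1}$ in $I$ the divided difference $f[x_0,\ldots,x_{p+1}]$ is $\ge 0$ (resp. $\le 0$), where $f[x_0,\ldots,x_n]=\sum_{k=0}^n f(x_k)/\prod_{j\ne k}(x_k-x_j)$. $\mathcal{K}^p_+$ (resp. $\mathcal{K}^p_-$) is the set of functions $\mathbb{R}_+\to\mathbb{R}$ that are $p$-convex (resp. $p$-concave) on some $[a,\infty)$, and $\mathcal{K}^p=\mathcal{K}^p_+\cup\mathcal{K}^p_-$. $\mathcal{D}^p$ is the set of $g\colon\mathbb{R}_+\to\mathbb{R}$ with $\Delta^pg(n)\to 0$ as $n\to\infty$ over the integers (for $g\in\mathcal{K}^p$ this is equivalent to $\Delta^pg(x)\to0$ as $x\to\infty$ over the reals). For $g\in\mathcal{D}^p\cap\mathcal{K}^p$, the function $\Sigma g\colon\mathbb{R}_+\to\mathbb{R}$ is $$\Sigma g(x)=\lim_{n\to\infty}\Big(-g(x)+\sum_{k=1}^{n-1}(g(k)-g(x+k))+\sum_{j=1}^p\binom{x}{j}\Delta^{j-1}g(n)\Big);$$ the limit exists, does not depend on the choice of $p$ with $g\in\mathcal{D}^p\cap\mathcal{K}^p$, and $\Sigma g$ is the unique solution $f\in\mathcal{K}^p$ of $\Delta f=g$ with $f(1)=0$.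 For $q\in\mathbb{N}$, $x>0$, $a\geq 0$: $\rho^q_x[f](a)=f(x+a)-\sum_{j=0}^{q-1}\binom{a}{j}\Delta^jf(x)$. For $k\in\mathbb{N}$, $\varepsilon_k(a)\in\{-1,0,1\}$ is the sign of $a(a-1)\cdots(a-k+1)$. *)

theory Defs
  imports Complex_Main
begin

text \<open>
  Functions on the open half-line \<open>(0,\<infinity>)\<close> are represented by total functions on
  \<^typ>\<open>real\<close>. In what follows only their values at positive arguments matter, provided
  the points at which the operators are evaluated are positive.
\<close>

definition fdiff :: "(real \<Rightarrow> real) \<Rightarrow> real \<Rightarrow> real" where
  "fdiff f x = f (x + 1) - f x"

definition divdiff :: "(real \<Rightarrow> real) \<Rightarrow> nat \<Rightarrow> (nat \<Rightarrow> real) \<Rightarrow> real" where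
  "divdiff f n x = (\<Sum>k\<le>n. f (x k) / (\<Prod>j\<in>{..n} - {k}. x k - x j))"

text \<open>The order \<open>p\<close> is an integer with \<open>p \<ge> -1\<close>; the \<open>p + 2\<close> nodes are indexed by
  \<open>0, \<dots>, p + 1\<close>.\<close>

definition p_convex_on :: "int \<Rightarrow> real set \<Rightarrow> (real \<Rightarrow> real) \<Rightarrow> bool" where
  "p_convex_on p I f \<longleftrightarrow>
     (\<forall>x. strict_mono_on {..nat (p + 1)} x \<and> x ` {..nat (p + 1)} \<subseteq> I
        \<longrightarrow> divdiff f (nat (p + 1)) x \<ge> 0)"

definition p_concave_on :: "int \<Rightarrow> real set \<Rightarrow> (real \<Rightarrow> real) \<Rightarrow> bool" where
  "p_concave_on p I f \<longleftrightarrow>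
     (\<forall>x. strict_mono_on {..nat (p + 1)} x \<and> x ` {..nat (p + 1)} \<subseteq> I
        \<longrightarrow> divdiff f (nat (p + 1)) x \<le> 0)"

definition K_plus :: "int \<Rightarrow> (real \<Rightarrow> real) set" where
  "K_plus p = {f. \<exists>a>0. p_convex_on p {a..} f}"

definition K_minus :: "int \<Rightarrow> (real \<Rightarrow> real) set" where
  "K_minus p = {f. \<exists>a>0. p_concave_on p {a..} f}"

definition K_class :: "int \<Rightarrow> (real \<Rightarrow> real) set" where
  "K_class p = K_plus p \<union> K_minus p"

definition D_class :: "nat \<Rightarrow> (real \<Rightarrow> real) set" where
  "D_class p = {g. (\<lambda>n::nat. (fdiff ^^ p) g (real n)) \<longlonglongrightarrow> 0}"

definition Sigma_seq :: "nat \<Rightarrow> (real \<Rightarrow> real) \<Rightarrow> nat \<Rightarrow> real \<Rightarrow> real" where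
  "Sigma_seq p g n x =
     - g x + (\<Sum>k=1..<n. g (real k) - g (x + real k))
     + (\<Sum>j=1..p. (x gchoose j) * (fdiff ^^ (j - 1)) g (real n))"

text \<open>The limit is the same for every \<open>p\<close> with \<open>g \<in> \<D>\<^sup>p \<inter> \<K>\<^sup>p\<close>, so \<open>p\<close> is not a
  parameter of the operator. The value is meaningful only if such a \<open>p\<close> exists and
  \<open>x > 0\<close>.\<close>

definition Sigma_op :: "(real \<Rightarrow> real) \<Rightarrow> real \<Rightarrow> real" where
  "Sigma_op g x =
     (THE L. \<forall>p. g \<in> D_class p \<inter> K_class (int p) \<longrightarrow> (\<lambda>n. Sigma_seq p g n x) \<longlonglongrightarrow> L)"

definition rho :: "nat \<Rightarrow> real \<Rightarrow> (real \<Rightarrow> real) \<Rightarrow> real \<Rightarrow> real" where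
  "rho q x f a = f (x + a) - (\<Sum>j<q. (a gchoose j) * (fdiff ^^ j) f x)"

definition eps :: "nat \<Rightarrow> real \<Rightarrow> real" where
  "eps k a = sgn (\<Prod>i<k. a - real i)"

end

theory Submission imports Defs begin

text \<open>
  Newton's interpolation formula identifies the remainder \<open>\<rho>\<^sup>q\<^sub>x[f](a)\<close> with
  \<open>a (a - 1) \<cdots> (a - q + 1)\<close> times the divided difference of \<open>f\<close> at the nodes
  \<open>x, x + 1, \<dots>, x + q - 1, x + a\<close> (\<open>rho_eq_set_divdiff\<close>). Convexity of order \<open>q - 1\<close> is the
  nonnegativity of that divided difference, so multiplying by the sign of the falling factorial
  makes the remainder nonnegative. Moreover, \<open>a\<close> times the same divided difference is the change
  of the divided difference of one order less when the node \<open>x\<close> is replaced by \<open>x + a\<close>; as these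
  increase in every node, moving the other nodes \<open>x + i\<close> to \<open>x + a + i\<close> as well gives the upper
  bound by a multiple of \<open>\<Delta>\<^sup>q\<^sup>-\<^sup>1 f(x + a) - \<Delta>\<^sup>q\<^sup>-\<^sup>1 f(x)\<close> (\<open>remainder_bounds\<close>). Telescoping
  this difference in unit steps yields the last bound (\<open>remainder_bounds_antimono\<close>).

  This single argument gives both chains of inequalities once the relevant functions are known to
  have the right convexity. Let \<open>g\<close> be \<open>p\<close>-convex with \<open>\<Delta>\<^sup>p g(n) \<rightarrow> 0\<close>. Its divided differences
  on \<open>p + 1\<close> nodes increase in every node and tend to \<open>0\<close> along \<open>n, \<dots>, n + p\<close>, hence are
  nonpositive: \<open>g\<close> is \<open>(p - 1)\<close>-concave (\<open>set_divdiff_nonpos_of_decay\<close>). The approximants of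
  \<open>\<Sigma>g\<close> are minus a sum of translates of \<open>g\<close>, plus a polynomial of degree at most \<open>p\<close>; they are
  \<open>p\<close>-concave, and so is their limit (\<open>Sigma_op_sgn_convex\<close>).

  The existence of \<open>\<Sigma>g\<close> rests on the same bounds. Up to sign, two consecutive approximants
  differ by \<open>\<rho>\<^sup>p\<^sup>+\<^sup>1\<^sub>n[g](x)\<close>, which \<open>remainder_bounds\<close> dominates by a multiple of an increment of
  the convergent sequence \<open>\<Delta>\<^sup>p g(n)\<close>; so the approximants converge. The defect in \<open>\<Delta>\<Sigma>g = g\<close> is
  \<open>\<rho>\<^sup>p\<^sub>n[g](x)\<close>, which vanishes in the limit. Raising the order \<open>p\<close> of the approximants adds only
  terms that tend to \<open>0\<close>, so the limit does not depend on it.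
\<close>

section \<open>Divided differences over finite sets\<close>

text \<open>The divided difference is symmetric in its nodes. Indexing it by the set of nodes builds this
  symmetry in, so that nodes can be added and exchanged without keeping them sorted.\<close>

definition set_divdiff :: "(real \<Rightarrow> real) \<Rightarrow> real set \<Rightarrow> real" where
  "set_divdiff f S = (\<Sum>y\<in>S. f y / (\<Prod>z\<in>S - {y}. y - z))"

lemma set_divdiff_insert:
  assumes "finite S" "c \<notin> S"
  shows "set_divdiff f (insert c S) =
    f c / (\<Prod>z\<in>S. c - z) + (\<Sum>y\<in>S. f y / ((y - c) * (\<Prod>z\<in>S - {y}. y - z)))"
proof -
  have "(\<Prod>z\<in>insert c S - {y}. y - z) = (y - c) * (\<Prod>z\<in>S - {y}. y - z)" if "y \<in> S" for y
  proof -
    have "insert c S - {y} = insert c (S - {y})" using that assms by auto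
    then show ?thesis using assms by simp
  qed
  moreover have "insert c S - {c} = S" using assms by auto
  ultimately show ?thesis using assms by (simp add: set_divdiff_def)
qed

lemma set_divdiff_singleton [simp]: "set_divdiff f {c} = f c"
  by (simp add: set_divdiff_def)

lemma set_divdiff_add: "set_divdiff (\<lambda>y. f y + h y) S = set_divdiff f S + set_divdiff h S"
  by (simp add: set_divdiff_def add_divide_distrib sum.distrib)

lemma set_divdiff_cmult: "set_divdiff (\<lambda>y. c * f y) S = c * set_divdiff f S"
  by (simp add: set_divdiff_def sum_distrib_left)

lemma set_divdiff_sum: "set_divdiff (\<lambda>y. \<Sum>i\<in>A. f i y) S = (\<Sum>i\<in>A. set_divdiff (f i) S)"
  unfolding set_divdiff_def sum_divide_distrib by (rule sum.swap)

lemma set_divdiff_translate: "set_divdiff (\<lambda>y. f (y + c)) S = set_divdiff f ((\<lambda>y. y + c) ` S)"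
proof -
  have inj: "inj_on (\<lambda>y. y + c) A" for A :: "real set" by (simp add: inj_on_def)
  have "(\<lambda>y. y + c) ` S - {y + c} = (\<lambda>y. y + c) ` (S - {y})" for y by auto
  then show ?thesis
    unfolding set_divdiff_def by (simp add: sum.reindex[OF inj] prod.reindex[OF inj])
qed

text \<open>The recursive definition of divided differences, read as the effect of moving one node from
  \<open>c\<close> to \<open>d\<close>. It follows term by term from
  \<open>1 / (y - d) - 1 / (y - c) = (d - c) / ((y - c) (y - d))\<close>.\<close>

lemma set_divdiff_exchange:
  assumes "finite S" "c \<notin> S" "d \<notin> S"
  shows "set_divdiff f (insert d S) - set_divdiff f (insert c S) = (d - c) * set_divdiff f (insert c (insert d S))"
proof (cases "c = d")
  case False
  have ne: "y - c \<noteq> 0" "y - d \<noteq> 0" if "y \<in> S" for y using that assms by auto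
  have cd: "c - d \<noteq> 0" "d - c \<noteq> 0" using False by auto
  let ?W = "\<lambda>y. \<Prod>z\<in>S - {y}. y - z"
  have W: "(\<Prod>z\<in>insert d S - {y}. y - z) = (y - d) * ?W y" if "y \<in> S" for y
  proof -
    have "insert d S - {y} = insert d (S - {y})" using that assms by auto
    then show ?thesis using assms by simp
  qed
  have Wd: "insert d S - {d} = S" using assms by auto
  have frac: "(d - c) * (f y / ((y - c) * ((y - d) * ?W y)))
      = f y / ((y - d) * ?W y) - f y / ((y - c) * ?W y)" if "y \<in> S" for y
  proof -
    have "(e1 - e2) * (F / (e1 * (e2 * w))) = F / (e2 * w) - F / (e1 * w)"
      if "e1 \<noteq> 0" "e2 \<noteq> 0" for F e1 e2 w :: real
      using that by (cases "w = 0") (auto simp: field_simps)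
    from this[OF ne[OF that]] show ?thesis by simp
  qed
  have "(d - c) * set_divdiff f (insert c (insert d S)) =
      (d - c) * (f c / ((c - d) * (\<Prod>z\<in>S. c - z))) + (d - c) * (f d / ((d - c) * (\<Prod>z\<in>S. d - z)))
      + (d - c) * (\<Sum>y\<in>S. f y / ((y - c) * ((y - d) * ?W y)))"
    using assms False by (simp add: set_divdiff_insert W Wd algebra_simps)
  also have "(d - c) * (f c / ((c - d) * (\<Prod>z\<in>S. c - z))) = - (f c / (\<Prod>z\<in>S. c - z))"
  proof -
    have "(d - c) * (f c / ((c - d) * P)) = - (f c / P)" for P
      using cd by (cases "P = 0") (auto simp: field_simps)
    then show ?thesis .
  qed
  also have "(d - c) * (f d / ((d - c) * (\<Prod>z\<in>S. d - z))) = f d / (\<Prod>z\<in>S. d - z)"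
    using cd by simp
  also have "(d - c) * (\<Sum>y\<in>S. f y / ((y - c) * ((y - d) * ?W y)))
      = (\<Sum>y\<in>S. f y / ((y - d) * ?W y)) - (\<Sum>y\<in>S. f y / ((y - c) * ?W y))"
    unfolding sum_distrib_left sum_subtractf[symmetric] by (rule sum.cong[OF refl]) (rule frac)
  finally show ?thesis using assms by (simp add: set_divdiff_insert)
qed auto

lemma set_divdiff_mult_linear:
  assumes "finite S" "c \<in> S"
  shows "set_divdiff (\<lambda>y. (y - c) * f y) S = set_divdiff f (S - {c})"
proof -
  define T where "T = S - {c}"
  have T: "S = insert c T" "finite T" "c \<notin> T" using assms by (auto simp: T_def)
  have "(y - c) * f y / ((y - c) * w) = f y / w" if "y \<in> T" for y w
    using that T by auto
  then have "set_divdiff (\<lambda>y. (y - c) * f y) (insert c T) = set_divdiff f T"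
    using T by (simp add: set_divdiff_insert) (simp add: set_divdiff_def)
  then show ?thesis using T by simp
qed

lemma set_divdiff_const:
  assumes "finite S" "card S \<ge> 2"
  shows "set_divdiff (\<lambda>y. C) S = 0"
  using assms
proof (induction "card S" arbitrary: S rule: less_induct)
  case less
  obtain c where c: "c \<in> S" using less.prems by (metis card.empty ex_in_conv not_numeral_le_zero)
  have "card (S - {c}) \<ge> 1" using less.prems c by simp
  then obtain d where d: "d \<in> S - {c}" by (metis card.empty ex_in_conv not_one_le_zero)
  define T where "T = S - {c} - {d}"
  have T: "S = insert c (insert d T)" "c \<notin> T" "d \<notin> T" "finite T" "c \<noteq> d"
    using c d less.prems by (auto simp: T_def)
  have "set_divdiff (\<lambda>y. C) (insert d T) = set_divdiff (\<lambda>y. C) (insert c T)"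
  proof (cases "T = {}")
    case False
    then have "card T \<ge> 1" using T by (simp add: Suc_leI card_gt_0_iff)
    then show ?thesis using T less.hyps[of "insert d T"] less.hyps[of "insert c T"] by simp
  qed simp
  then have "(d - c) * set_divdiff (\<lambda>y. C) S = 0"
    using set_divdiff_exchange[of T c d "\<lambda>y. C"] T by simp
  then show ?case using T by simp
qed

text \<open>Divided differences annihilate polynomials of low degree: for a node \<open>c\<close>, writing
  \<open>y - j = (y - c) + (c - j)\<close> in the last factor lowers the degree, because the factor \<open>y - c\<close>
  merely removes the node \<open>c\<close>.\<close>

lemma set_divdiff_falling_factorial:
  assumes "finite S" "card S \<ge> j + 2"
  shows "set_divdiff (\<lambda>y. \<Prod>i<j. y - real i) S = 0"
  using assms
proof (induction j arbitrary: S)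
  case 0
  then show ?case by (simp add: set_divdiff_const)
next
  case (Suc j)
  obtain c where c: "c \<in> S" using Suc.prems by (metis card.empty ex_in_conv not_less_eq_eq zero_le add_Suc)
  let ?q = "\<lambda>y. \<Prod>i<j. y - real i"
  have "(\<lambda>y. \<Prod>i<Suc j. y - real i) = (\<lambda>y. (y - c) * ?q y + (c - real j) * ?q y)"
    by (auto simp: algebra_simps)
  then have "set_divdiff (\<lambda>y. \<Prod>i<Suc j. y - real i) S = set_divdiff ?q (S - {c}) + (c - real j) * set_divdiff ?q S"
    using Suc.prems c by (simp only: set_divdiff_add set_divdiff_cmult set_divdiff_mult_linear)
  moreover have "card (S - {c}) \<ge> j + 2" using Suc.prems c by simp
  ultimately show ?case using Suc.IH[of S] Suc.IH[of "S - {c}"] Suc.prems by simp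
qed

lemma gchoose_eq_prod: "(a::real) gchoose k = (\<Prod>i<k. a - real i) / fact k"
  by (simp add: gbinomial_prod_rev atLeast0LessThan)

lemma set_divdiff_gchoose:
  assumes "finite S" "card S \<ge> j + 2"
  shows "set_divdiff (\<lambda>y. y gchoose j) S = 0"
  using set_divdiff_cmult[of "1 / fact j" "\<lambda>y. \<Prod>i<j. y - real i" S] set_divdiff_falling_factorial[OF assms]
  by (simp add: gchoose_eq_prod)

section \<open>Equally spaced nodes, and Newton's remainder\<close>

definition knots :: "real \<Rightarrow> nat \<Rightarrow> real set" where
  "knots x n = (\<lambda>i. x + real i) ` {..<n}"

lemma finite_knots [simp]: "finite (knots x n)"
  by (simp add: knots_def)

lemma knots_Suc: "knots x (Suc n) = insert (x + real n) (knots x n)"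
  by (auto simp: knots_def lessThan_Suc)

lemma knots_Suc_shift: "knots x (Suc n) = insert x (knots (x + 1) n)"
  by (auto simp: knots_def lessThan_Suc_eq_insert_0 image_image add.assoc)

lemma fdiff_funpow_Suc: "(fdiff ^^ Suc n) f x = (fdiff ^^ n) f (x + 1) - (fdiff ^^ n) f x"
  by (simp add: fdiff_def)

lemma set_divdiff_knots: "set_divdiff f (knots x (Suc n)) = (fdiff ^^ n) f x / fact n"
proof (induction n arbitrary: x)
  case 0
  then show ?case by (simp add: knots_def lessThan_Suc)
next
  case (Suc n)
  have notin: "x \<notin> knots (x + 1) n" "x + 1 + real n \<notin> knots (x + 1) n" by (auto simp: knots_def)
  have "(1 + real n) * set_divdiff f (knots x (Suc (Suc n)))
      = set_divdiff f (knots (x + 1) (Suc n)) - set_divdiff f (knots x (Suc n))"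
    using set_divdiff_exchange[OF _ notin, of f]
    by (simp add: knots_Suc_shift[of x] knots_Suc[of "x + 1"])
  also have "\<dots> = (fdiff ^^ Suc n) f x / fact n"
    by (simp add: Suc.IH fdiff_funpow_Suc diff_divide_distrib del: funpow.simps(2))
  finally have "set_divdiff f (knots x (Suc (Suc n))) = (fdiff ^^ Suc n) f x / fact n / (1 + real n)"
    by (metis nonzero_mult_div_cancel_left of_nat_Suc of_nat_neq_0)
  then show ?case by (simp add: mult.commute del: funpow.simps)
qed

lemma rho_Suc: "rho (Suc q) x f a = rho q x f a - (a gchoose q) * (fdiff ^^ q) f x"
  by (simp add: rho_def)

text \<open>Newton's interpolation formula. Passing from \<open>q\<close> to \<open>q + 1\<close> subtracts the divided difference
  over \<open>x, \<dots>, x + q\<close>, that is, exchanges the node \<open>x + q\<close> for \<open>x + a\<close>.\<close>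

lemma rho_eq_set_divdiff:
  assumes "\<And>i. i < q \<Longrightarrow> a \<noteq> real i"
  shows "rho q x f a = (\<Prod>i<q. a - real i) * set_divdiff f (insert (x + a) (knots x q))"
  using assms
proof (induction q)
  case 0
  then show ?case by (simp add: rho_def knots_def)
next
  case (Suc q)
  have notin: "x + real q \<notin> knots x q" "x + a \<notin> knots x q"
    using Suc.prems by (force simp: knots_def)+
  have "rho (Suc q) x f a = (\<Prod>i<q. a - real i) *
      (set_divdiff f (insert (x + a) (knots x q)) - set_divdiff f (insert (x + real q) (knots x q)))"
    using Suc by (simp add: rho_Suc gchoose_eq_prod set_divdiff_knots flip: knots_Suc)
      (simp add: algebra_simps)
  also have "\<dots> = (\<Prod>i<q. a - real i) * ((a - real q)
      * set_divdiff f (insert (x + real q) (insert (x + a) (knots x q))))"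
    using set_divdiff_exchange[OF _ notin, of f] by simp
  finally show ?case by (simp add: knots_Suc insert_commute)
qed

text \<open>At \<open>a = i < q\<close> the polynomial of degree below \<open>q\<close> interpolates \<open>f\<close>. The node \<open>x + a\<close>
  then coincides with another one, so the formula for the remainder is applied with \<open>q = i\<close>, the
  last order at which it makes sense; the term of index \<open>i\<close> cancels that remainder and all later
  binomial coefficients vanish.\<close>

lemma rho_eq_0:
  assumes "i < q"
  shows "rho q x f (real i) = 0"
  using assms
proof (induction q)
  case (Suc q)
  show ?case
  proof (cases "i < q")
    case True
    then have "real i gchoose q = 0" by (simp add: binomial_gbinomial[symmetric])
    then show ?thesis using Suc True by (simp add: rho_Suc)
  next
    case False
    then have i: "i = q" using Suc.prems by simp
    have "rho q x f (real q) = (\<Prod>i<q. real q - real i) * set_divdiff f (knots x (Suc q))"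
      by (subst rho_eq_set_divdiff) (auto simp: knots_Suc)
    also have "\<dots> = (real q gchoose q) * (fdiff ^^ q) f x"
      by (simp add: gchoose_eq_prod set_divdiff_knots)
    finally show ?thesis by (simp add: i rho_Suc)
  qed
qed simp

lemma fdiff_funpow_cong:
  assumes "\<And>y. y \<ge> x \<Longrightarrow> f y = h y"
  shows "(fdiff ^^ n) f x = (fdiff ^^ n) h x"
  using assms by (induction n arbitrary: x) (simp_all add: fdiff_def)

section \<open>Convexity of higher order\<close>

text \<open>With \<open>s = 1\<close> this is \<open>p\<close>-convexity and with \<open>s = -1\<close> it is \<open>p\<close>-concavity. All inequalities
  below are linear in \<open>s\<close>, so both cases are treated at once.\<close>

definition sgn_convex :: "real \<Rightarrow> nat \<Rightarrow> real set \<Rightarrow> (real \<Rightarrow> real) \<Rightarrow> bool" where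
  "sgn_convex s p I f \<longleftrightarrow> (\<forall>S. finite S \<and> card S = p + 2 \<and> S \<subseteq> I \<longrightarrow> 0 \<le> s * set_divdiff f S)"

lemma divdiff_eq_set_divdiff:
  assumes "inj_on u {..n}"
  shows "divdiff f n u = set_divdiff f (u ` {..n})"
proof -
  have "(\<Prod>z\<in>u ` {..n} - {u k}. u k - z) = (\<Prod>j\<in>{..n} - {k}. u k - u j)" if "k \<le> n" for k
  proof -
    have "u ` {..n} - {u k} = u ` ({..n} - {k})"
      using inj_on_image_set_diff[OF assms, of "{..n}" "{k}"] that by simp
    moreover have "inj_on u ({..n} - {k})" using assms by (rule inj_on_subset) auto
    ultimately show ?thesis by (simp add: prod.reindex)
  qed
  then show ?thesis
    unfolding set_divdiff_def divdiff_def by (simp add: sum.reindex[OF assms])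
qed

lemma increasing_enumeration:
  fixes S :: "real set"
  assumes "finite S" "card S = Suc n"
  obtains u :: "nat \<Rightarrow> real" where "strict_mono_on {..n} u" "u ` {..n} = S"
proof
  let ?l = "sorted_list_of_set S"
  have len: "length ?l = Suc n" using assms by simp
  show "strict_mono_on {..n} (\<lambda>i. ?l ! i)"
    using len by (auto intro!: strict_mono_onI sorted_wrt_nth_less[OF strict_sorted_list_of_set])
  show "(\<lambda>i. ?l ! i) ` {..n} = S"
    using len nth_image[of "Suc n" ?l] assms by (simp add: lessThan_Suc_atMost atLeast0LessThan)
qed

lemma sgn_convex_of_p_convex:
  assumes "s = 1 \<and> p_convex_on (int p) I f \<or> s = -1 \<and> p_concave_on (int p) I f"
  shows "sgn_convex s p I f"
  unfolding sgn_convex_def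
proof (intro allI impI)
  fix S assume S: "finite S \<and> card S = p + 2 \<and> S \<subseteq> I"
  then obtain u where u: "strict_mono_on {..p + 1} u" "u ` {..p + 1} = S"
    using increasing_enumeration[of S "p + 1"] by auto
  have "divdiff f (p + 1) u = set_divdiff f S"
    using divdiff_eq_set_divdiff[OF strict_mono_on_imp_inj_on[OF u(1)]] u(2) by simp
  moreover have "nat (int p + 1) = p + 1" by simp
  ultimately show "0 \<le> s * set_divdiff f S"
    using assms S u unfolding p_convex_on_def p_concave_on_def by fastforce
qed

lemma sgn_convex_subset:
  "sgn_convex s p I f \<Longrightarrow> J \<subseteq> I \<Longrightarrow> sgn_convex s p J f"
  unfolding sgn_convex_def by blast

text \<open>The nodes are moved from \<open>u\<close> to \<open>v\<close> one at a time, the one of largest index first, and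
  \<open>set_divdiff_exchange\<close> compares consecutive stages. Besides injectivity, \<open>u i \<noteq> v j\<close> for \<open>i < j\<close>
  is what keeps the nodes distinct at every stage.\<close>

lemma set_divdiff_mono:
  assumes conv: "sgn_convex s p I f"
    and u: "inj_on u {..p}" "u ` {..p} \<subseteq> I"
    and v: "inj_on v {..p}" "v ` {..p} \<subseteq> I"
    and le: "\<And>i. i \<le> p \<Longrightarrow> u i \<le> v i"
    and ne: "\<And>i j. i < j \<Longrightarrow> j \<le> p \<Longrightarrow> u i \<noteq> v j"
  shows "s * set_divdiff f (u ` {..p}) \<le> s * set_divdiff f (v ` {..p})"
proof -
  \<comment> \<open>the stage at which the nodes of index at least \<open>m\<close> have been moved\<close>
  define w where "w m i = (if i < m then u i else v i)" for m i
  have step: "s * set_divdiff f (w (Suc m) ` {..p}) \<le> s * set_divdiff f (w m ` {..p})" if m: "m \<le> p" for m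
  proof -
    define S where "S = w m ` ({..p} - {m})"
    have split: "h ` {..p} = insert (h m) (h ` ({..p} - {m}))" for h :: "nat \<Rightarrow> real" using m by auto
    have S': "w (Suc m) ` ({..p} - {m}) = S" unfolding S_def by (rule image_cong) (auto simp: w_def)
    have im: "w (Suc m) ` {..p} = insert (u m) S" "w m ` {..p} = insert (v m) S"
      using split[of "w (Suc m)"] split[of "w m"] S' by (simp_all add: w_def S_def)
    have inj: "inj_on (w m) {..p}" for m
      using u(1) v(1) ne unfolding inj_on_def w_def
      by (smt (verit, best) atMost_iff linorder_less_linear not_less less_le_trans)
    have um: "u m \<notin> S" and vm: "v m \<notin> S"
    proof -
      have "w (Suc m) m \<notin> w (Suc m) ` ({..p} - {m})" "w m m \<notin> w m ` ({..p} - {m})"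
        by (subst inj_on_image_mem_iff[OF inj]; use m in auto)+
      then show "u m \<notin> S" "v m \<notin> S" unfolding S' S_def[symmetric] by (simp_all add: w_def)
    qed
    have fin: "finite S" by (simp add: S_def)
    have card: "card S = p"
    proof -
      have "inj_on (w m) ({..p} - {m})" using inj by (rule inj_on_subset) auto
      then show ?thesis using m by (simp add: S_def card_image)
    qed
    have sub: "S \<subseteq> I" using u(2) v(2) by (auto simp: S_def w_def)
    show ?thesis
    proof (cases "u m = v m")
      case False
      have "0 \<le> s * set_divdiff f (insert (u m) (insert (v m) S))"
        using conv fin card um vm False sub u(2) v(2) m unfolding sgn_convex_def
        by (auto simp: image_subset_iff)
      then have "0 \<le> (v m - u m) * (s * set_divdiff f (insert (u m) (insert (v m) S)))"
        using le[OF m] by simp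
      also have "\<dots> = s * set_divdiff f (insert (v m) S) - s * set_divdiff f (insert (u m) S)"
        using set_divdiff_exchange[OF fin um vm, of f] by (simp flip: right_diff_distrib)
      finally show ?thesis by (simp add: im)
    qed (simp add: im)
  qed
  have "s * set_divdiff f (w m ` {..p}) \<le> s * set_divdiff f (w 0 ` {..p})" if "m \<le> Suc p" for m
    using that by (induction m) (auto intro: order_trans[OF step])
  moreover have "w (Suc p) ` {..p} = u ` {..p}" "w 0 ` {..p} = v ` {..p}"
    by (rule image_cong; simp add: w_def)+
  ultimately show ?thesis by (metis order_refl)
qed

lemma knots_eq_image: "knots x (Suc p) = (\<lambda>i. x + real i) ` {..p}"
  by (simp add: knots_def lessThan_Suc_atMost)

lemma fdiff_funpow_mono:
  assumes "sgn_convex s p {x..} f" "x \<le> y" "y \<le> z"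
  shows "s * (fdiff ^^ p) f y \<le> s * (fdiff ^^ p) f z"
proof -
  have "s * set_divdiff f (knots y (Suc p)) \<le> s * set_divdiff f (knots z (Suc p))"
    unfolding knots_eq_image
    by (rule set_divdiff_mono[OF assms(1)]) (use assms in \<open>auto simp: inj_on_def\<close>)
  then show ?thesis by (simp add: set_divdiff_knots divide_le_cancel)
qed

section \<open>Bounds for Newton's remainder\<close>

lemma eps_zero_iff: "eps q a = 0 \<longleftrightarrow> (\<exists>i<q. a = real i)"
  by (auto simp: eps_def sgn_0_0)

text \<open>If \<open>a\<close> is one of \<open>0, \<dots>, q\<close>, the sign \<open>eps (Suc q) a\<close> is zero and only the monotonicity of
  \<open>\<Delta>\<^sup>q f\<close> is needed. Otherwise Newton's formula applies: the remainder is the falling factorial,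
  which equals \<open>a\<close> times \<open>q!\<close> times the binomial coefficient of \<open>a - 1\<close>, times a divided difference
  \<open>D\<close>; and \<open>a D\<close> is at most the difference of two divided differences over \<open>q + 1\<close> equally
  spaced nodes.\<close>

lemma remainder_bounds:
  assumes conv: "sgn_convex t q {x..} f" and a: "a \<ge> 0"
  shows "0 \<le> t * eps (Suc q) a * rho (Suc q) x f a"
    and "t * eps (Suc q) a * rho (Suc q) x f a
      \<le> t * \<bar>(a - 1) gchoose q\<bar> * ((fdiff ^^ q) f (x + a) - (fdiff ^^ q) f x)"
proof -
  have mono: "0 \<le> t * ((fdiff ^^ q) f (x + a) - (fdiff ^^ q) f x)"
    using fdiff_funpow_mono[OF conv, of x "x + a"] a by (simp add: algebra_simps)
  have "0 \<le> t * eps (Suc q) a * rho (Suc q) x f a \<and> t * eps (Suc q) a * rho (Suc q) x f a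
      \<le> t * \<bar>(a - 1) gchoose q\<bar> * ((fdiff ^^ q) f (x + a) - (fdiff ^^ q) f x)"
  proof (cases "eps (Suc q) a = 0")
    case True
    then show ?thesis using mult_nonneg_nonneg[OF abs_ge_zero mono, of "(a - 1) gchoose q"]
      by (simp add: mult_ac)
  next
    case False
    then have ne: "a \<noteq> real i" if "i < Suc q" for i using that by (auto simp: eps_zero_iff)
    define K where "K = (\<lambda>i. x + real i) ` {1..q}"
    have K: "knots x (Suc q) = insert x K" "x \<notin> K" "x + a \<notin> K" "finite K" "card K = q" "K \<subseteq> {x..}"
    proof -
      have "{..q} = insert 0 {1..q}" by auto
      then show "knots x (Suc q) = insert x K" by (simp add: knots_eq_image K_def)
      show "card K = q" by (simp add: K_def card_image inj_on_def)
      show "x + a \<notin> K" using ne by (auto simp: K_def) (metis less_Suc_eq_le)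
    qed (auto simp: K_def)
    have a0: "a \<noteq> 0" using ne[of 0] by simp
    let ?P = "\<Prod>i<Suc q. a - real i" and ?D = "set_divdiff f (insert (x + a) (knots x (Suc q)))"
    have nonneg: "0 \<le> t * ?D"
      using conv K a a0 unfolding sgn_convex_def by simp
    have rho: "t * eps (Suc q) a * rho (Suc q) x f a = \<bar>?P\<bar> * (t * ?D)"
    proof -
      have "t * eps (Suc q) a * rho (Suc q) x f a = (sgn ?P * ?P) * (t * ?D)"
        using ne by (subst rho_eq_set_divdiff) (auto simp: eps_def simp del: prod.lessThan_Suc)
      also have "sgn ?P * ?P = \<bar>?P\<bar>" by (simp only: abs_sgn mult.commute)
      finally show ?thesis .
    qed
    have P: "\<bar>?P\<bar> = \<bar>(a - 1) gchoose q\<bar> * fact q * a"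
    proof -
      have "?P = a * (\<Prod>i<q. (a - 1) - real i)"
        by (subst prod.lessThan_Suc_shift) (simp add: algebra_simps)
      then have "?P = ((a - 1) gchoose q) * fact q * a" by (simp add: gchoose_eq_prod)
      then show ?thesis using a by (simp add: abs_mult)
    qed
    \<comment> \<open>The node \<open>x + a\<close> is already in place and keeps index \<open>0\<close>; each other \<open>x + i\<close> moves to
      \<open>x + a + i\<close>.\<close>
    let ?u = "\<lambda>i. if i = 0 then x + a else x + real i"
    have u: "?u ` {..q} = insert (x + a) K"
    proof -
      have q: "{..q} = insert 0 {1..q}" by auto
      have K: "?u ` {1..q} = K" unfolding K_def by (rule image_cong) auto
      show ?thesis unfolding q image_insert K by simp
    qed
    have "s * set_divdiff f (insert (x + a) K) \<le> s * set_divdiff f (knots (x + a) (Suc q))" if "s = t" for s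
      unfolding u[symmetric] knots_eq_image that
    proof (rule set_divdiff_mono[OF conv])
      show "inj_on ?u {..q}" using ne by (auto simp: inj_on_def less_Suc_eq_le)
    qed (use a in \<open>auto simp: inj_on_def\<close>)
    then have le: "t * set_divdiff f (insert (x + a) K) \<le> t * set_divdiff f (knots (x + a) (Suc q))" by simp
    have "a * (t * ?D) = t * (set_divdiff f (insert (x + a) K) - set_divdiff f (knots x (Suc q)))"
      using set_divdiff_exchange[OF K(4,2,3), of f] K(1) by (simp add: insert_commute mult_ac)
    also have "\<dots> \<le> t * (set_divdiff f (knots (x + a) (Suc q)) - set_divdiff f (knots x (Suc q)))"
      using le by (simp add: right_diff_distrib)
    finally have "fact q * (a * (t * ?D)) \<le>
        fact q * (t * (set_divdiff f (knots (x + a) (Suc q)) - set_divdiff f (knots x (Suc q))))"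
      by (rule mult_left_mono) simp
    also have "\<dots> = t * ((fdiff ^^ q) f (x + a) - (fdiff ^^ q) f x)"
      by (simp add: set_divdiff_knots field_simps)
    finally have "\<bar>(a - 1) gchoose q\<bar> * (fact q * (a * (t * ?D)))
        \<le> \<bar>(a - 1) gchoose q\<bar> * (t * ((fdiff ^^ q) f (x + a) - (fdiff ^^ q) f x))"
      by (rule mult_left_mono) simp
    moreover have "\<bar>(a - 1) gchoose q\<bar> * (fact q * (a * (t * ?D))) = \<bar>?P\<bar> * (t * ?D)"
      unfolding P by (simp only: mult_ac)
    moreover have "\<bar>(a - 1) gchoose q\<bar> * (t * X) = t * \<bar>(a - 1) gchoose q\<bar> * X" for X
      by (simp only: mult_ac)
    moreover have "0 \<le> \<bar>?P\<bar> * (t * ?D)" by (intro mult_nonneg_nonneg abs_ge_zero nonneg)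
    ultimately show ?thesis unfolding rho by simp
  qed
  then show "0 \<le> t * eps (Suc q) a * rho (Suc q) x f a"
    and "t * eps (Suc q) a * rho (Suc q) x f a
      \<le> t * \<bar>(a - 1) gchoose q\<bar> * ((fdiff ^^ q) f (x + a) - (fdiff ^^ q) f x)" by auto
qed


text \<open>Rounding \<open>a\<close> up to an integer enlarges the left side and makes it a sum of \<open>\<lceil>a\<rceil>\<close> values of
  \<open>G\<close>, of which, after multiplication by \<open>t\<close>, the first is the largest.\<close>

lemma telescoping_bound:
  fixes F G :: "real \<Rightarrow> real"
  assumes diff: "\<And>y. x \<le> y \<Longrightarrow> F (y + 1) - F y = G y"
    and mono: "\<And>y z. x \<le> y \<Longrightarrow> y \<le> z \<Longrightarrow> t * F y \<le> t * F z"
    and anti: "\<And>y. x \<le> y \<Longrightarrow> t * G y \<le> t * G x"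
    and a: "a \<ge> 0"
  shows "t * (F (x + a) - F x) \<le> t * of_int \<lceil>a\<rceil> * G x"
proof -
  have bound: "t * (F (x + real m) - F x) \<le> real m * (t * G x)" for m
  proof (induction m)
    case (Suc m)
    have "F (x + real (Suc m)) = F (x + real m) + G (x + real m)"
      using diff[of "x + real m"] by (simp add: algebra_simps)
    then show ?case using Suc anti[of "x + real m"] by (simp add: algebra_simps)
  qed simp
  have m: "real (nat \<lceil>a\<rceil>) = of_int \<lceil>a\<rceil>" using a by simp
  have "t * F (x + a) \<le> t * F (x + real (nat \<lceil>a\<rceil>))"
    by (rule mono) (use a m in auto)
  then show ?thesis
    using bound[of "nat \<lceil>a\<rceil>"] m by (simp add: algebra_simps)
qed

text \<open>The difference \<open>\<Delta>\<^sup>q\<^sup>+\<^sup>1 f\<close> enters as a separate function \<open>G\<close> because for \<open>f = \<Sigma>g\<close> it is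
  \<open>\<Delta>\<^sup>p g\<close> only at positive arguments.\<close>

lemma remainder_bounds_antimono:
  assumes conv: "sgn_convex t q {x..} f" and a: "a \<ge> 0"
    and diff: "\<And>y. x \<le> y \<Longrightarrow> (fdiff ^^ Suc q) f y = G y"
    and anti: "\<And>y. x \<le> y \<Longrightarrow> t * G y \<le> t * G x"
  defines "A \<equiv> t * eps (Suc q) a * rho (Suc q) x f a"
    and "B \<equiv> t * \<bar>(a - 1) gchoose q\<bar> * ((fdiff ^^ q) f (x + a) - (fdiff ^^ q) f x)"
    and "C \<equiv> t * of_int \<lceil>a\<rceil> * \<bar>(a - 1) gchoose q\<bar> * G x"
  shows "0 \<le> A \<and> A \<le> B \<and> B \<le> C \<and> (a \<in> real ` {0..q} \<longrightarrow> 0 = A \<and> A = B \<and> B = C)"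
proof (intro conjI impI)
  show "0 \<le> A" "A \<le> B" using remainder_bounds[OF conv a] by (simp_all add: A_def B_def)
  have "t * ((fdiff ^^ q) f (x + a) - (fdiff ^^ q) f x) \<le> t * of_int \<lceil>a\<rceil> * G x"
    by (rule telescoping_bound[where F = "(fdiff ^^ q) f" and G = G, OF _ fdiff_funpow_mono[OF conv] anti a])
      (use diff in \<open>auto simp: fdiff_def\<close>)
  then show "B \<le> C"
    using mult_left_mono[OF _ abs_ge_zero, of _ _ "(a - 1) gchoose q"]
    by (fastforce simp: B_def C_def mult_ac)
next
  assume "a \<in> real ` {0..q}"
  then obtain i where i: "a = real i" "i \<le> q" by auto
  have "A = 0" using i eps_zero_iff[of "Suc q" a] by (auto simp: A_def less_Suc_eq_le)
  moreover have "B = 0 \<and> C = 0"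
  proof (cases i)
    case (Suc k)
    then have "(a - 1) gchoose q = 0"
      using i by (simp add: binomial_gbinomial[symmetric])
    then show ?thesis by (simp add: B_def C_def)
  qed (simp add: i B_def C_def)
  ultimately show "0 = A" "A = B" "B = C" by auto
qed

lemma abs_rho_le:
  assumes "t = 1 \<or> t = -1" "t * eps q a * rho q x f a \<le> M" "0 \<le> t * eps q a * rho q x f a" "a \<ge> 0"
  shows "\<bar>rho q x f a\<bar> \<le> M"
proof (cases "eps q a = 0")
  case True
  then show ?thesis using assms(2) rho_eq_0 by (auto simp: eps_zero_iff)
next
  case False
  moreover have "\<bar>sgn P\<bar> = 1" if "sgn P \<noteq> 0" for P :: real using that by (auto simp: abs_sgn_eq sgn_0_0)
  ultimately have "\<bar>eps q a\<bar> = 1" unfolding eps_def by blast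
  then have "\<bar>t * eps q a\<bar> = 1" using assms(1) by (auto simp: abs_mult)
  then have "\<bar>rho q x f a\<bar> = \<bar>t * eps q a * rho q x f a\<bar>" by (simp add: abs_mult)
  then show ?thesis using assms by simp
qed

text \<open>The upper bound in \<open>remainder_bounds_antimono\<close> is a constant multiple of \<open>\<Delta>\<^sup>q\<^sup>+\<^sup>1 f(x)\<close>.\<close>

lemma rho_tendsto_0:
  assumes t: "t = 1 \<or> t = -1" and conv: "sgn_convex t q {N..} f" and a: "a \<ge> 0"
    and diff: "\<And>y. N \<le> y \<Longrightarrow> (fdiff ^^ Suc q) f y = G y"
    and anti: "\<And>y z. N \<le> y \<Longrightarrow> y \<le> z \<Longrightarrow> t * G z \<le> t * G y"
    and lim: "(G \<longlongrightarrow> 0) at_top"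
  shows "((\<lambda>x. rho (Suc q) x f a) \<longlongrightarrow> 0) at_top"
proof (rule tendsto_0_le)
  show "\<forall>\<^sub>F x in at_top. norm (rho (Suc q) x f a)
      \<le> norm (t * of_int \<lceil>a\<rceil> * \<bar>(a - 1) gchoose q\<bar> * G x) * 1"
    using eventually_ge_at_top[of N]
  proof eventually_elim
    case (elim x)
    have "sgn_convex t q {x..} f" using sgn_convex_subset[OF conv] elim by simp
    from remainder_bounds_antimono[OF this a, of G] diff anti elim
    have "\<bar>rho (Suc q) x f a\<bar> \<le> t * of_int \<lceil>a\<rceil> * \<bar>(a - 1) gchoose q\<bar> * G x"
      using abs_rho_le[OF t, of "Suc q" a x f] a by fastforce
    then show ?case unfolding real_norm_def mult_1_right by linarith
  qed
  show "((\<lambda>x. t * of_int \<lceil>a\<rceil> * \<bar>(a - 1) gchoose q\<bar> * G x) \<longlongrightarrow> 0) at_top"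
    using tendsto_mult_left[OF lim] by simp
qed

section \<open>Consequences of decay\<close>

text \<open>The nodes in \<open>S\<close> are pushed up to \<open>n, \<dots>, n + p\<close> with \<open>n\<close> beyond all of them. This increases
  the signed divided difference, and the new value \<open>\<Delta>\<^sup>p g(n) / p!\<close> tends to \<open>0\<close>.\<close>

lemma set_divdiff_nonpos_of_decay:
  assumes conv: "sgn_convex s p {x..} g"
    and decay: "(\<lambda>n. (fdiff ^^ p) g (real n)) \<longlonglongrightarrow> 0"
    and S: "finite S" "card S = Suc p" "S \<subseteq> {x..}"
  shows "s * set_divdiff g S \<le> 0"
proof -
  obtain u where u: "strict_mono_on {..p} u" "u ` {..p} = S"
    using increasing_enumeration[OF S(1,2)] .
  have "s * set_divdiff g S \<le> s * ((fdiff ^^ p) g (real n) / fact p)" if n: "Max S < real n" for n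
  proof -
    have un: "x \<le> u i" "u i < real n" if "i \<le> p" for i
    proof -
      have "u i \<in> S" using u that by auto
      then show "x \<le> u i" "u i < real n"
        using S(3) Max_ge[OF S(1) \<open>u i \<in> S\<close>] n by auto
    qed
    have "s * set_divdiff g (u ` {..p}) \<le> s * set_divdiff g ((\<lambda>i. real n + real i) ` {..p})"
    proof (rule set_divdiff_mono[OF conv])
      show "inj_on u {..p}" using u(1) by (rule strict_mono_on_imp_inj_on)
      show "(\<lambda>i. real n + real i) ` {..p} \<subseteq> {x..}" using un[of 0] by auto
      show "u i \<le> real n + real i" if "i \<le> p" for i using un[OF that] by simp
      show "u i \<noteq> real n + real j" if "i < j" "j \<le> p" for i j using un[of i] that by simp
    qed (use un in \<open>auto simp: inj_on_def\<close>)
    then show ?thesis by (simp add: u(2) set_divdiff_knots flip: knots_eq_image)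
  qed
  moreover have "\<forall>\<^sub>F n in sequentially. Max S < real n"
    by (rule filterlim_real_sequentially[THEN filterlim_at_top_dense[THEN iffD1], rule_format])
  ultimately have "\<forall>\<^sub>F n in sequentially. s * set_divdiff g S \<le> s * ((fdiff ^^ p) g (real n) / fact p)"
    by (auto elim: eventually_mono)
  moreover have "(\<lambda>n. s * ((fdiff ^^ p) g (real n) / fact p)) \<longlonglongrightarrow> s * (0 / fact p)"
    using decay by (intro tendsto_intros) auto
  ultimately show ?thesis
    using tendsto_lowerbound[OF _ _ sequentially_bot] by fastforce
qed

lemma sgn_convex_lower_order:
  assumes "sgn_convex s (Suc q) {x..} g"
    and "(\<lambda>n. (fdiff ^^ Suc q) g (real n)) \<longlonglongrightarrow> 0"
  shows "sgn_convex (s * (-1)) q {x..} g"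
  using set_divdiff_nonpos_of_decay[OF assms] unfolding sgn_convex_def by simp

lemma fdiff_funpow_nonpos:
  assumes "sgn_convex s p {x..} g" "(\<lambda>n. (fdiff ^^ p) g (real n)) \<longlonglongrightarrow> 0" "x \<le> y"
  shows "s * (fdiff ^^ p) g y \<le> 0"
proof -
  have "knots y (Suc p) \<subseteq> {x..}" "card (knots y (Suc p)) = Suc p"
    using assms(3) by (auto simp: knots_eq_image card_image inj_on_def)
  then have "s * set_divdiff g (knots y (Suc p)) \<le> 0"
    by (intro set_divdiff_nonpos_of_decay[OF assms(1,2)]) auto
  then show ?thesis by (auto simp: set_divdiff_knots divide_le_0_iff dest: leD)
qed

text \<open>Monotonicity transfers the limit from the integers to the reals: the signed difference at \<open>y\<close>
  lies between its value at \<open>\<lfloor>y\<rfloor>\<close> and \<open>0\<close>.\<close>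

lemma fdiff_funpow_tendsto_0:
  assumes s: "s = 1 \<or> s = -1" and conv: "sgn_convex s p {x..} g"
    and decay: "(\<lambda>n. (fdiff ^^ p) g (real n)) \<longlonglongrightarrow> 0"
  shows "((fdiff ^^ p) g \<longlongrightarrow> 0) at_top"
proof (rule tendsto_0_le)
  let ?n = "\<lambda>y::real. nat \<lfloor>y\<rfloor>"
  show "\<forall>\<^sub>F y in at_top. norm ((fdiff ^^ p) g y) \<le> norm ((fdiff ^^ p) g (real (?n y))) * 1"
    using eventually_ge_at_top[of "\<bar>x\<bar> + 1"]
  proof eventually_elim
    case (elim y)
    have n: "x \<le> real (?n y)" "real (?n y) \<le> y" using elim by linarith+
    have "s * (fdiff ^^ p) g (real (?n y)) \<le> s * (fdiff ^^ p) g y"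
      using fdiff_funpow_mono[OF conv n] .
    then show ?case
      using fdiff_funpow_nonpos[OF conv decay, of y] n s by auto
  qed
  have "filterlim ?n sequentially at_top"
    by (rule filterlim_compose[OF filterlim_nat_sequentially filterlim_floor_sequentially])
  from filterlim_compose[OF decay this]
  show "((\<lambda>y. (fdiff ^^ p) g (real (?n y))) \<longlongrightarrow> 0) at_top" .
qed

section \<open>The principal indefinite sum\<close>

lemma D_class_mono:
  assumes "g \<in> D_class p" "p \<le> q"
  shows "g \<in> D_class q"
  using assms(2,1)
proof (induction q rule: dec_induct)
  case (step q)
  then have "(\<lambda>n. (fdiff ^^ q) g (real n)) \<longlonglongrightarrow> 0" by (simp add: D_class_def)
  from tendsto_diff[OF LIMSEQ_Suc[OF this] this]
  show ?case by (simp add: D_class_def fdiff_def add.commute)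
qed

text \<open>The two approximants differ by finitely many terms, each a constant multiple of a difference of
  \<open>g\<close> of order at least \<open>p\<close>.\<close>

lemma Sigma_seq_order_independent:
  assumes "g \<in> D_class p" "p \<le> q"
  shows "(\<lambda>n. Sigma_seq q g n x - Sigma_seq p g n x) \<longlonglongrightarrow> 0"
proof -
  have split: "(\<Sum>j=1..q. F j) - (\<Sum>j=1..p. F j) = (\<Sum>j=Suc p..q. F j)" for F :: "nat \<Rightarrow> real"
    using sum.ub_add_nat[of 1 p F "q - p"] assms(2) by simp
  have eq: "Sigma_seq q g n x - Sigma_seq p g n x
      = (\<Sum>j=Suc p..q. (x gchoose j) * (fdiff ^^ (j - 1)) g (real n))" for n
    unfolding Sigma_seq_def split[symmetric] by simp
  have "(\<lambda>n. \<Sum>j=Suc p..q. (x gchoose j) * (fdiff ^^ (j - 1)) g (real n)) \<longlonglongrightarrow>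
      (\<Sum>j=Suc p..q. (x gchoose j) * 0)"
    using D_class_mono[OF assms(1)] by (intro tendsto_intros) (auto simp: D_class_def)
  then show ?thesis by (simp add: eq)
qed

text \<open>The description of \<open>\<Sigma>g\<close> quantifies over all admissible orders; the limit at a single one
  determines it.\<close>

lemma Sigma_op_eqI:
  assumes mem: "g \<in> D_class p \<inter> K_class (int p)" and lim: "(\<lambda>n. Sigma_seq p g n x) \<longlonglongrightarrow> L"
  shows "Sigma_op g x = L"
  unfolding Sigma_op_def
proof (rule the_equality)
  have "(\<lambda>n. Sigma_seq q g n x) \<longlonglongrightarrow> L" if q: "g \<in> D_class q" for q
  proof (cases "p \<le> q")
    case True
    from tendsto_add[OF Sigma_seq_order_independent[OF _ this, of g x] lim] mem
    show ?thesis by simp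
  next
    case False
    then have "q \<le> p" by simp
    from tendsto_diff[OF lim Sigma_seq_order_independent[OF q this, of x]]
    show ?thesis by simp
  qed
  then show "\<forall>q. g \<in> D_class q \<inter> K_class (int q) \<longrightarrow> (\<lambda>n. Sigma_seq q g n x) \<longlonglongrightarrow> L" by blast
  show "L' = L" if "\<forall>q. g \<in> D_class q \<inter> K_class (int q) \<longrightarrow> (\<lambda>n. Sigma_seq q g n x) \<longlonglongrightarrow> L'" for L'
    using that mem LIMSEQ_unique[OF _ lim] by blast
qed

text \<open>The next two identities explain the form of the approximants: their increments in \<open>n\<close> and their
  failure to solve \<open>\<Delta>f = g\<close> are both Newton remainders of \<open>g\<close>, based at \<open>n\<close>.\<close>

lemma Sigma_seq_Suc:
  assumes "n \<ge> 1"
  shows "Sigma_seq p g (Suc n) x - Sigma_seq p g n x = - rho (Suc p) (real n) g x"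
proof -
  have "(\<Sum>j=1..p. (x gchoose j) * (fdiff ^^ (j - 1)) g (real (Suc n)))
      - (\<Sum>j=1..p. (x gchoose j) * (fdiff ^^ (j - 1)) g (real n))
      = (\<Sum>j<p. (x gchoose Suc j) * (fdiff ^^ Suc j) g (real n))"
    by (simp add: sum.atLeast1_atMost_eq fdiff_def algebra_simps flip: sum_subtractf)
  moreover have "rho (Suc p) (real n) g x
      = g (real n + x) - g (real n) - (\<Sum>j<p. (x gchoose Suc j) * (fdiff ^^ Suc j) g (real n))"
    unfolding rho_def sum.lessThan_Suc_shift by simp
  ultimately show ?thesis
    using assms by (simp add: Sigma_seq_def add.commute)
qed

lemma Sigma_seq_step:
  assumes "n \<ge> 1"
  shows "Sigma_seq p g n (y + 1) - Sigma_seq p g n y = g y - rho p (real n) g y"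
proof -
  have "(\<Sum>j=1..p. ((y + 1) gchoose j) * (fdiff ^^ (j - 1)) g (real n))
      - (\<Sum>j=1..p. (y gchoose j) * (fdiff ^^ (j - 1)) g (real n))
      = (\<Sum>j<p. (y gchoose j) * (fdiff ^^ j) g (real n))"
    by (simp add: sum.atLeast1_atMost_eq gbinomial_Suc_Suc distrib_right flip: sum_subtractf)
  moreover have "(\<Sum>k=1..<n. g (real k) - g (y + 1 + real k)) - (\<Sum>k=1..<n. g (real k) - g (y + real k))
      = - (\<Sum>k=1..<n. g (y + real (Suc k)) - g (y + real k))"
    by (simp add: algebra_simps flip: sum_subtractf sum_negf)
  moreover have "\<dots> = g (y + 1) - g (y + real n)"
    using sum_Suc_diff'[OF assms, of "\<lambda>k. g (y + real k)"] by simp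
  ultimately show ?thesis by (simp add: Sigma_seq_def rho_def add.commute)
qed

text \<open>Membership in \<open>\<K>\<^sup>p\<close> leaves open the sign of the convexity and where it begins; the locale
  fixes both.\<close>

locale summand =
  fixes g :: "real \<Rightarrow> real" and p :: nat and s N :: real
  assumes mem: "g \<in> D_class p \<inter> K_class (int p)"
    and s: "s = 1 \<or> s = -1"
    and N: "N > 0"
    and conv: "sgn_convex s p {N..} g"
begin

lemma decay: "(\<lambda>n. (fdiff ^^ p) g (real n)) \<longlonglongrightarrow> 0"
  using mem by (simp add: D_class_def)

lemma neg_fdiff_antimono: "N \<le> y \<Longrightarrow> y \<le> z \<Longrightarrow> s * (-1) * (fdiff ^^ p) g z \<le> s * (-1) * (fdiff ^^ p) g y"
  using fdiff_funpow_mono[OF conv] by simp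

lemma fdiff_tendsto_0: "((fdiff ^^ p) g \<longlongrightarrow> 0) at_top"
  using fdiff_funpow_tendsto_0[OF s conv decay] .

lemma lower_sgn_convex: "p = Suc q \<Longrightarrow> sgn_convex (s * (-1)) q {N..} g"
  using sgn_convex_lower_order conv decay by blast

text \<open>For \<open>p = 0\<close> the remainder is \<open>g(x + a)\<close> itself; for larger \<open>p\<close> the function \<open>g\<close> has convexity
  of order \<open>p - 1\<close> with the opposite sign.\<close>

lemma rho_lower_tendsto_0:
  assumes "a \<ge> 0"
  shows "((\<lambda>x. rho p x g a) \<longlongrightarrow> 0) at_top"
proof (cases p)
  case 0
  have "((\<lambda>x. g (a + x)) \<longlongrightarrow> 0) at_top"
    using fdiff_tendsto_0 by (intro filterlim_compose[OF _ filterlim_tendsto_add_at_top[OF tendsto_const filterlim_ident]])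
      (simp add: 0)
  then show ?thesis by (simp add: 0 rho_def add.commute)
next
  case (Suc q)
  show ?thesis unfolding Suc
    by (rule rho_tendsto_0[OF _ lower_sgn_convex[OF Suc] assms _ neg_fdiff_antimono fdiff_tendsto_0]) (use s Suc in auto)
qed

text \<open>Enlarging the shift \<open>a\<close> to the integer \<open>m = \<lceil>a\<rceil>\<close> bounds the remainder by a multiple of
  \<open>v (n + m) - v n\<close>, where \<open>v\<close> is the convergent sequence of signed differences \<open>\<Delta>\<^sup>p g(n)\<close>. That
  bound is a sum of \<open>m\<close> telescoping summable sequences.\<close>

lemma summable_rho:
  assumes a: "a \<ge> 0"
  shows "summable (\<lambda>n. rho (Suc p) (real n) g a)"
proof -
  define v where "v n = s * (fdiff ^^ p) g (real n)" for n
  define m where "m = nat \<lceil>a\<rceil>"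
  have v: "v \<longlonglongrightarrow> 0" unfolding v_def using tendsto_mult_left[OF decay, of s] by simp
  have "v (n + m) - v n = (\<Sum>k<m. v (Suc (n + k)) - v (n + k))" for n
    using sum_lessThan_telescope[of "\<lambda>k. v (n + k)" m] by simp
  moreover have "summable (\<lambda>n. v (Suc (n + k)) - v (n + k))" for k
    using telescope_summable[OF LIMSEQ_ignore_initial_segment[OF v, of k]] by simp
  ultimately have "summable (\<lambda>n. v (n + m) - v n)" by (simp add: summable_sum)
  then have sum: "summable (\<lambda>n. \<bar>(a - 1) gchoose p\<bar> * (v (n + m) - v n))" by (rule summable_mult)
  have "\<forall>\<^sub>F n in sequentially. norm (rho (Suc p) (real n) g a) \<le> \<bar>(a - 1) gchoose p\<bar> * (v (n + m) - v n)"
    using filterlim_real_sequentially[unfolded filterlim_at_top, rule_format, of N]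
  proof eventually_elim
    case (elim n)
    have conv_n: "sgn_convex s p {real n..} g" using sgn_convex_subset[OF conv] elim by simp
    have "s * (fdiff ^^ p) g (real n + a) \<le> v (n + m)"
      unfolding v_def by (rule fdiff_funpow_mono[OF conv_n]) (use a in \<open>simp_all add: m_def\<close>)
    then have "\<bar>(a - 1) gchoose p\<bar> * (s * (fdiff ^^ p) g (real n + a) - v n)
        \<le> \<bar>(a - 1) gchoose p\<bar> * (v (n + m) - v n)"
      by (intro mult_left_mono) auto
    then have "s * eps (Suc p) a * rho (Suc p) (real n) g a
        \<le> \<bar>(a - 1) gchoose p\<bar> * (v (n + m) - v n)"
      using remainder_bounds(2)[OF conv_n a] by (simp add: v_def algebra_simps)
    then show ?case
      using abs_rho_le[OF s] remainder_bounds(1)[OF conv_n a] a by simp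
  qed
  then show ?thesis using sum by (rule summable_comparison_test_ev)
qed

lemma Sigma_seq_tendsto:
  assumes "y > 0"
  shows "(\<lambda>n. Sigma_seq p g n y) \<longlonglongrightarrow> Sigma_op g y"
proof -
  \<comment> \<open>The increments are remainders only from \<open>n = 1\<close> on, hence the shift of the index.\<close>
  let ?F = "\<lambda>n. Sigma_seq p g (Suc n) y"
  have "summable (\<lambda>n. rho (Suc p) (real (Suc n)) g y)"
    using summable_rho[of y] assms by (subst summable_Suc_iff) simp
  then have "summable (\<lambda>n. ?F (Suc n) - ?F n)"
    by (subst Sigma_seq_Suc) (auto intro: summable_minus)
  then have "(\<lambda>n. (\<Sum>k<n. ?F (Suc k) - ?F k)) \<longlonglongrightarrow> (\<Sum>n. ?F (Suc n) - ?F n)"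
    by (rule summable_LIMSEQ)
  then have "(\<lambda>n. ?F n - ?F 0) \<longlonglongrightarrow> (\<Sum>n. ?F (Suc n) - ?F n)"
    by (simp only: sum_lessThan_telescope[of ?F])
  from tendsto_add[OF this tendsto_const[of "?F 0"]]
  have "?F \<longlonglongrightarrow> (\<Sum>n. ?F (Suc n) - ?F n) + ?F 0" by simp
  then have lim: "(\<lambda>n. Sigma_seq p g n y) \<longlonglongrightarrow> (\<Sum>n. ?F (Suc n) - ?F n) + ?F 0"
    by (rule LIMSEQ_imp_Suc)
  then show ?thesis unfolding Sigma_op_eqI[OF mem lim] .
qed

lemma fdiff_Sigma_op:
  assumes "y > 0"
  shows "fdiff (Sigma_op g) y = g y"
proof -
  have "(\<lambda>n. Sigma_seq p g n (y + 1) - Sigma_seq p g n y) \<longlonglongrightarrow> Sigma_op g (y + 1) - Sigma_op g y"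
    using assms by (intro tendsto_diff Sigma_seq_tendsto) auto
  moreover have "\<forall>\<^sub>F n in sequentially.
      Sigma_seq p g n (y + 1) - Sigma_seq p g n y = g y - rho p (real n) g y"
    using eventually_ge_at_top[of 1] by eventually_elim (rule Sigma_seq_step)
  ultimately have 1: "(\<lambda>n. g y - rho p (real n) g y) \<longlonglongrightarrow> Sigma_op g (y + 1) - Sigma_op g y"
    by (rule Lim_transform_eventually)
  have "(\<lambda>n. rho p (real n) g y) \<longlonglongrightarrow> 0"
    using filterlim_compose[OF rho_lower_tendsto_0 filterlim_real_sequentially] assms by simp
  then have "(\<lambda>n. g y - rho p (real n) g y) \<longlonglongrightarrow> g y - 0"
    by (intro tendsto_diff tendsto_const)
  with 1 show ?thesis
    unfolding fdiff_def using LIMSEQ_unique by fastforce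
qed

lemma fdiff_funpow_Sigma_op:
  assumes "y > 0"
  shows "(fdiff ^^ Suc p) (Sigma_op g) y = (fdiff ^^ p) g y"
  unfolding funpow_Suc_right comp_apply
  by (rule fdiff_funpow_cong) (use assms in \<open>simp add: fdiff_Sigma_op\<close>)

text \<open>On \<open>p + 2\<close> nodes the constant and the binomial polynomials of degree at most \<open>p\<close> contribute
  nothing, so up to sign only translates of \<open>g\<close> to the right remain.\<close>

lemma Sigma_seq_sgn_convex: "sgn_convex (s * (-1)) p {N..} (Sigma_seq p g n)"
  unfolding sgn_convex_def
proof (intro allI impI)
  fix S assume S: "finite S \<and> card S = p + 2 \<and> S \<subseteq> {N..}"
  \<comment> \<open>The summand \<open>g y\<close> is the translate with \<open>k = 0\<close>; it is present even for \<open>n = 0\<close>, whence the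
    maximum.\<close>
  have "Sigma_seq p g n = (\<lambda>y. (-1) * (\<Sum>k=0..<max 1 n. g (y + real k))
      + ((\<Sum>k=1..<n. g (real k)) + (\<Sum>j=1..p. (fdiff ^^ (j - 1)) g (real n) * (y gchoose j))))"
  proof
    fix y
    have "(\<Sum>k=0..<max 1 n. g (y + real k)) = g y + (\<Sum>k=1..<n. g (y + real k))"
      by (cases n) (simp_all add: sum.atLeast_Suc_lessThan max_def)
    then show "Sigma_seq p g n y = (-1) * (\<Sum>k=0..<max 1 n. g (y + real k))
      + ((\<Sum>k=1..<n. g (real k)) + (\<Sum>j=1..p. (fdiff ^^ (j - 1)) g (real n) * (y gchoose j)))"
      by (simp add: Sigma_seq_def sum_subtractf mult.commute)
  qed
  then have "set_divdiff (Sigma_seq p g n) S = - (\<Sum>k=0..<max 1 n. set_divdiff g ((\<lambda>y. y + real k) ` S))"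
    using S by (simp only: set_divdiff_add set_divdiff_cmult set_divdiff_sum set_divdiff_translate) (simp add: set_divdiff_const set_divdiff_gchoose)
  moreover have "0 \<le> s * set_divdiff g ((\<lambda>y. y + real k) ` S)" for k
  proof -
    have "(\<lambda>y. y + real k) ` S \<subseteq> {N..}" using S by (auto intro: add_increasing2)
    moreover have "card ((\<lambda>y. y + real k) ` S) = p + 2" using S by (simp add: card_image inj_on_def)
    ultimately show ?thesis using conv S unfolding sgn_convex_def by blast
  qed
  then have "0 \<le> (\<Sum>k=0..<max 1 n. s * set_divdiff g ((\<lambda>y. y + real k) ` S))" by (rule sum_nonneg)
  ultimately show "0 \<le> s * (-1) * set_divdiff (Sigma_seq p g n) S"
    by (simp flip: sum_distrib_left)
qed

lemma Sigma_op_sgn_convex: "sgn_convex (s * (-1)) p {N..} (Sigma_op g)"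
  unfolding sgn_convex_def
proof (intro allI impI)
  fix S assume S: "finite S \<and> card S = p + 2 \<and> S \<subseteq> {N..}"
  then have "(\<lambda>n. s * (-1) * set_divdiff (Sigma_seq p g n) S) \<longlonglongrightarrow> s * (-1) * set_divdiff (Sigma_op g) S"
    unfolding set_divdiff_def using N by (intro tendsto_intros Sigma_seq_tendsto) auto
  moreover have "0 \<le> s * (-1) * set_divdiff (Sigma_seq p g n) S" for n
    using Sigma_seq_sgn_convex[of n] S unfolding sgn_convex_def by blast
  ultimately show "0 \<le> s * (-1) * set_divdiff (Sigma_op g) S"
    by (intro LIMSEQ_le_const) auto
qed

lemma rho_Sigma_op_tendsto_0:
  assumes "a \<ge> 0"
  shows "((\<lambda>x. rho (Suc p) x (Sigma_op g) a) \<longlongrightarrow> 0) at_top"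
  by (rule rho_tendsto_0[OF _ Sigma_op_sgn_convex assms fdiff_funpow_Sigma_op neg_fdiff_antimono fdiff_tendsto_0])
    (use s N in auto)

end

theorem theorem6p1:
  fixes g :: "real \<Rightarrow> real" and p :: nat
  assumes "g \<in> D_class p \<inter> K_class (int p)"
  shows
    "(\<forall>x s a :: real.
        x > 0 \<and> (s = 1 \<and> p_convex_on (int p) {x..} g \<or> s = -1 \<and> p_concave_on (int p) {x..} g)
          \<and> a \<ge> 0 \<longrightarrow>
        (let A = s * (-1) * eps (p + 1) a * rho (p + 1) x (Sigma_op g) a;
             B = s * (-1) * \<bar>(a - 1) gchoose p\<bar>
                   * ((fdiff ^^ p) (Sigma_op g) (x + a) - (fdiff ^^ p) (Sigma_op g) x);
             C = s * (-1) * of_int \<lceil>a\<rceil> * \<bar>(a - 1) gchoose p\<bar> * (fdiff ^^ p) g x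
         in 0 \<le> A \<and> A \<le> B \<and> B \<le> C \<and>
            (a \<in> real ` {0..p} \<longrightarrow> 0 = A \<and> A = B \<and> B = C)))
     \<and> (\<forall>a\<ge>0. ((\<lambda>x. rho (p + 1) x (Sigma_op g) a) \<longlongrightarrow> 0) at_top)
     \<and> (p \<ge> 1 \<longrightarrow>
         (\<forall>x s a :: real.
            x > 0 \<and> (s = 1 \<and> p_convex_on (int p) {x..} g \<or> s = -1 \<and> p_concave_on (int p) {x..} g)
              \<and> a \<ge> 0 \<longrightarrow>
            (let A = s * (-1) * eps p a * rho p x g a;
                 B = s * (-1) * \<bar>(a - 1) gchoose (p - 1)\<bar>
                       * ((fdiff ^^ (p - 1)) g (x + a) - (fdiff ^^ (p - 1)) g x);
                 C = s * (-1) * of_int \<lceil>a\<rceil> * \<bar>(a - 1) gchoose (p - 1)\<bar> * (fdiff ^^ p) g x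
             in 0 \<le> A \<and> A \<le> B \<and> B \<le> C \<and>
                (a \<in> real ` {0..p - 1} \<longrightarrow> 0 = A \<and> A = B \<and> B = C)))
         \<and> (\<forall>a\<ge>0. ((\<lambda>x. rho p x g a) \<longlongrightarrow> 0) at_top))"
proof -
  have start: "summand g p s x"
    if "x > 0" "s = 1 \<and> p_convex_on (int p) {x..} g \<or> s = -1 \<and> p_concave_on (int p) {x..} g" for x s
    using assms that sgn_convex_of_p_convex[OF that(2)] by unfold_locales auto
  from assms obtain s N :: real where "N > 0"
    "s = 1 \<and> p_convex_on (int p) {N..} g \<or> s = -1 \<and> p_concave_on (int p) {N..} g"
    unfolding K_class_def K_plus_def K_minus_def by blast
  then interpret ev: summand g p s N by (rule start)
  show ?thesis
  proof (intro conjI allI impI)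
    fix x s a :: real
    assume H: "x > 0 \<and> (s = 1 \<and> p_convex_on (int p) {x..} g \<or> s = -1 \<and> p_concave_on (int p) {x..} g)
      \<and> a \<ge> 0"
    then interpret summand g p s x using start by blast
    show "let A = s * (-1) * eps (p + 1) a * rho (p + 1) x (Sigma_op g) a;
             B = s * (-1) * \<bar>(a - 1) gchoose p\<bar>
                   * ((fdiff ^^ p) (Sigma_op g) (x + a) - (fdiff ^^ p) (Sigma_op g) x);
             C = s * (-1) * of_int \<lceil>a\<rceil> * \<bar>(a - 1) gchoose p\<bar> * (fdiff ^^ p) g x
         in 0 \<le> A \<and> A \<le> B \<and> B \<le> C \<and> (a \<in> real ` {0..p} \<longrightarrow> 0 = A \<and> A = B \<and> B = C)"
      unfolding Let_def Suc_eq_plus1[symmetric]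
      by (rule remainder_bounds_antimono[OF Sigma_op_sgn_convex _ fdiff_funpow_Sigma_op neg_fdiff_antimono])
        (use H in auto)
  next
    fix a :: real assume "a \<ge> 0"
    then show "((\<lambda>x. rho (p + 1) x (Sigma_op g) a) \<longlongrightarrow> 0) at_top"
      using ev.rho_Sigma_op_tendsto_0 by simp
  next
    fix x s a :: real
    assume "p \<ge> 1"
    then obtain q where q: "p = Suc q" by (cases p) auto
    assume H: "x > 0 \<and> (s = 1 \<and> p_convex_on (int p) {x..} g \<or> s = -1 \<and> p_concave_on (int p) {x..} g)
      \<and> a \<ge> 0"
    then interpret summand g p s x using start by blast
    have "p - 1 = q" using q by simp
    then show "let A = s * (-1) * eps p a * rho p x g a;
             B = s * (-1) * \<bar>(a - 1) gchoose (p - 1)\<bar>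
                   * ((fdiff ^^ (p - 1)) g (x + a) - (fdiff ^^ (p - 1)) g x);
             C = s * (-1) * of_int \<lceil>a\<rceil> * \<bar>(a - 1) gchoose (p - 1)\<bar> * (fdiff ^^ p) g x
         in 0 \<le> A \<and> A \<le> B \<and> B \<le> C \<and> (a \<in> real ` {0..p - 1} \<longrightarrow> 0 = A \<and> A = B \<and> B = C)"
      unfolding Let_def
      using remainder_bounds_antimono[OF lower_sgn_convex[OF q], where G = "(fdiff ^^ p) g" and a = a]
        neg_fdiff_antimono[OF order_refl] H unfolding q by simp
  next
    fix a :: real assume "a \<ge> 0"
    then show "((\<lambda>x. rho p x g a) \<longlongrightarrow> 0) at_top" by (rule ev.rho_lower_tendsto_0)
  qed
qed

end
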